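(* There exist universal constants $c,C>0$, and for every $\beta>1$ a constant $C_\beta>0$ depending only on $\beta$, such that the following holds for $Y\sim\mathrm{Gamma}(\alpha)$ and $X=Y-\alpha$. (a) For all $\alpha\ge1$ and $x\ge0$, $$c\exp\left(-C\left(x\wedge\frac{x^2}{\alpha}\right)\right)\le\mathbb{P}(X\ge x)\le\exp\left(-c\left(x\wedge\frac{x^2}{\alpha}\right)\right).$$ For any $\beta>1$, all $\alpha\ge1$ and all $0\le x\le\frac{\alpha}{\beta}$, $$c\exp\left(-C_\beta\frac{x^2}{\alpha}\right)\le\mathbb{P}(X\le-x)\le\exp\left(-\frac{x^2}{2\alpha}\right).$$ For any $x>\alpha$, $\mathbb{P}(X\le-x)=0$. (b) For all $0<\alpha<1$ and all $x\ge0$, $$\frac1e\cdot\frac{(\alpha+x+1)^\alpha-(\alpha+x)^\alpha}{e^{\alpha+x}\Gamma(\alpha+1)}\le\mathbb{P}(X\ge x)\le\frac{e}{e-1}\cdot\frac{(\alpha+x+1)^\alpha-(\alpha+x)^\alpha}{e^{\alpha+x}\Gamma(\alpha+1)},$$ $$\frac{\{(\alpha-x)\vee0\}^\alpha}{e\,\Gamma(\alpha+1)}\le\mathbb{P}(X\le-x)\le\frac{\{(\alpha-x)\vee0\}^\alpha}{\Gamma(\alpha+1)}.$$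
   Context: $\mathrm{Gamma}(\alpha)$, $\alpha>0$, is the distribution with density $f(y;\alpha)=\frac{1}{\Gamma(\alpha)}y^{\alpha-1}e^{-y}$ for $y>0$, where $\Gamma$ is the gamma function. $x\wedge y$ and $x\vee y$ denote the minimum and the maximum of $x$ and $y$. *)

theory Defs
  imports "HOL-Probability.Probability"
begin

definition gamma_density :: "real \<Rightarrow> real \<Rightarrow> real" where
  "gamma_density \<alpha> y = (if y > 0 then y powr (\<alpha> - 1) * exp (- y) / Gamma \<alpha> else 0)"

definition gamma_distribution :: "real \<Rightarrow> real measure" where
  "gamma_distribution \<alpha> = density lborel (\<lambda>y. ennreal (gamma_density \<alpha> y))"

lemma borel_measurable_gamma_density [measurable]: "gamma_density \<alpha> \<in> borel_measurable borel"
  unfolding gamma_density_def[abs_def] by measurable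

lemma sets_gamma_distribution [simp, measurable_cong]: "sets (gamma_distribution \<alpha>) = sets borel"
  by (simp add: gamma_distribution_def)

lemma space_gamma_distribution [simp]: "space (gamma_distribution \<alpha>) = UNIV"
  by (simp add: gamma_distribution_def)

lemma prob_space_gamma_distribution:
  assumes "\<alpha> > 0"
  shows "prob_space (gamma_distribution \<alpha>)"
proof
  have G: "Gamma \<alpha> > 0"
    using assms by (rule Gamma_real_pos)
  have "emeasure (gamma_distribution \<alpha>) (space (gamma_distribution \<alpha>)) =
      (\<integral>\<^sup>+y. ennreal (gamma_density \<alpha> y) \<partial>lborel)"
    by (simp add: gamma_distribution_def emeasure_density)
  also have "\<dots> = (\<integral>\<^sup>+y. ennreal (1 / Gamma \<alpha>) *
      ennreal (indicator {0..} y * y powr (\<alpha> - 1) / exp y) \<partial>lborel)"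
    using G by (intro nn_integral_cong)
      (auto simp: gamma_density_def ennreal_mult'[symmetric] exp_minus field_simps indicator_def)
  also have "\<dots> = ennreal (1 / Gamma \<alpha>) * ennreal (Gamma \<alpha>)"
    using assms by (simp add: nn_integral_cmult Gamma_conv_nn_integral_real)
  also have "\<dots> = 1"
    using G by (simp add: ennreal_mult'[symmetric])
  finally show "emeasure (gamma_distribution \<alpha>) (space (gamma_distribution \<alpha>)) = 1" .
qed

text \<open>
  Probabilities of events about a random variable \<open>Y\<close> with law \<open>gamma_distribution \<alpha>\<close> on any
  sample space agree with those of the identity on \<open>gamma_distribution \<alpha>\<close>. Constants that must be
  uniform over all sample spaces are therefore quantified over statements about this measure; in HOL
  a type variable for the sample space could not be quantified inside the scope of the constants.
\<close>

lemma distributed_gamma_prob_eq: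
  fixes Y :: "'a \<Rightarrow> real"
  assumes "distributed M lborel Y (gamma_density \<alpha>)" and "Measurable.pred borel Q"
  shows "\<P>(\<omega> in M. Q (Y \<omega>)) = \<P>(y in gamma_distribution \<alpha>. Q y)"
proof -
  have Y: "Y \<in> measurable M lborel"
    using assms(1) by (rule distributed_measurable)
  have Q: "{y. Q y} \<in> sets lborel"
    using assms(2) by (simp add: pred_def)
  have "\<P>(y in gamma_distribution \<alpha>. Q y) = measure (distr M lborel Y) {y. Q y}"
    using distributed_distr_eq_density[OF assms(1)] by (simp add: gamma_distribution_def)
  also have "\<dots> = \<P>(\<omega> in M. Q (Y \<omega>))"
    using Y Q by (subst measure_distr) (auto intro!: arg_cong[where f = "measure M"])
  finally show ?thesis ..
qed

end

theory Submission
  imports Defs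
begin

text \<open>
  For shape \<open>\<alpha> \<ge> 1\<close> everything is governed by the Cramer rate function \<open>h v = v - 1 - ln v\<close> of the exponential
  law. Put \<open>p t = exp (- \<alpha> * h (t / \<alpha>))\<close>. Then the density at \<open>t > 0\<close> is exactly a constant \<open>M\<close> times
  \<open>p t / t\<close>, and Chernoff's inequality at a level \<open>t\<close> on either side of the mean \<open>\<alpha>\<close> says that the tail
  beyond \<open>t\<close> is at most \<open>p t\<close>. Since \<open>h v\<close> lies between \<open>(v - 1)\<^sup>2 / (2 * max v 1)\<close> and
  \<open>(v - 1)\<^sup>2 / v\<close>, the factor \<open>p t\<close> is Gaussian in \<open>t - \<alpha>\<close> on the scale \<open>sqrt \<alpha>\<close> up to \<open>t\<close> of order
  \<open>\<alpha>\<close>, and exponential beyond; this is the minimum of \<open>x\<close> and \<open>x\<^sup>2 / \<alpha>\<close>.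

  The upper bounds follow at once. For the lower bounds one integrates the density over an interval that
  starts at the threshold and has length of order \<open>sqrt \<alpha>\<close> (or \<open>x\<close>, in the exponential regime),
  which needs a lower bound for \<open>M\<close> of order \<open>sqrt \<alpha>\<close>. Stirling's formula would provide it, but
  concentration does so more cheaply (\<open>gamma_peak_ge\<close>): by the Chernoff bounds a window of width
  of order \<open>sqrt \<alpha>\<close> around the mean has probability bounded below, while the density on it is at most of
  order \<open>M / \<alpha>\<close>. In the lower tail the interval must stay away from \<open>0\<close>; with
  \<open>\<delta> = 1 - 1 / \<beta>\<close> it can only have length of order \<open>\<delta> * sqrt \<alpha>\<close> when \<open>x\<close> is comparable to \<open>\<alpha>\<close>. The
  factor \<open>\<delta>\<close> lost in this way goes into the exponent, since there \<open>x\<^sup>2 / \<alpha>\<close> is bounded below; hence the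
  prefactor does not depend on \<open>\<beta>\<close>.

  For \<open>\<alpha> < 1\<close> the factor \<open>exp (- y)\<close> varies by at most \<open>exp 1\<close> over an interval of length \<open>1\<close>, and
  \<open>y powr (\<alpha> - 1)\<close> has an explicit primitive. The lower tail lives on such an interval because
  it lies below the mean \<open>\<alpha>\<close>. The upper tail beyond \<open>t\<close> is its part on \<open>{t..t + 1}\<close> plus the tail beyond \<open>t + 1\<close>, and
  the latter is at most \<open>exp (- 1)\<close> times the tail itself because \<open>y powr (\<alpha> - 1)\<close> is decreasing.
\<close>

section \<open>The rate function\<close>

text \<open>
  The two sides agree at \<open>1\<close>, and their difference has the derivative \<open>(w - 1)\<^sup>2 / (2 * w\<^sup>2)\<close>. The
  denominator \<open>2 * v\<close> makes the bound linear for large \<open>v\<close>, as it has to be.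
\<close>

lemma rate_ge_right_of_one:
  assumes "v \<ge> (1::real)"
  shows "(v - 1)\<^sup>2 / (2 * v) \<le> v - 1 - ln v"
proof -
  let ?h = "\<lambda>v::real. v - 1 - ln v - (v - 1)\<^sup>2 / (2 * v)"
  have "?h 1 \<le> ?h v"
  proof (rule DERIV_nonneg_imp_nondecreasing[OF assms])
    fix w :: real assume "1 \<le> w" "w \<le> v"
    then have "(?h has_real_derivative (w - 1)\<^sup>2 / (2 * w\<^sup>2)) (at w)"
      by (auto intro!: derivative_eq_intros simp: field_simps power2_eq_square)
    then show "\<exists>y. (?h has_real_derivative y) (at w) \<and> 0 \<le> y"
      by (intro exI conjI) auto
  qed
  then show ?thesis by simp
qed

text \<open>
  Below \<open>1\<close> the rate is at least its own second-order Taylor polynomial, which yields the exact Gaussian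
  exponent of the lower tail.
\<close>

lemma rate_ge_left_of_one:
  assumes "0 < v" "v \<le> (1::real)"
  shows "(v - 1)\<^sup>2 / 2 \<le> v - 1 - ln v"
proof -
  let ?h = "\<lambda>v::real. v - 1 - ln v - (v - 1)\<^sup>2 / 2"
  have "?h 1 \<le> ?h v"
  proof (rule DERIV_nonpos_imp_nonincreasing[OF assms(2)])
    fix w :: real assume "v \<le> w" "w \<le> 1"
    then have "(?h has_real_derivative - ((w - 1)\<^sup>2 / w)) (at w)"
      using assms(1)
      by (auto intro!: derivative_eq_intros simp: field_simps power2_eq_square)
    then show "\<exists>y. (?h has_real_derivative y) (at w) \<and> y \<le> 0"
      using assms(1) \<open>v \<le> w\<close> by (intro exI conjI) auto
  qed
  then show ?thesis by simp
qed

text \<open>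
  The Chernoff bound for the law with shape \<open>\<alpha>\<close> at level \<open>t\<close>; at the same time, up to the factor
  \<open>1 / t\<close> and a constant, its density.
\<close>

definition gamma_profile :: "real \<Rightarrow> real \<Rightarrow> real" where
  "gamma_profile \<alpha> t = exp (- \<alpha> * (t / \<alpha> - 1 - ln (t / \<alpha>)))"

text \<open>
  This is \<open>\<alpha>\<close> times the density at the mean \<open>\<alpha>\<close>. By Stirling's formula it is asymptotic to
  \<open>sqrt (\<alpha> / (2 * pi))\<close>.
\<close>

definition gamma_peak :: "real \<Rightarrow> real" where
  "gamma_peak \<alpha> = \<alpha> powr \<alpha> * exp (- \<alpha>) / Gamma \<alpha>"

lemma gamma_density_eq_profile:
  assumes "\<alpha> > 0" "t > 0"
  shows "gamma_density \<alpha> t = gamma_peak \<alpha> * gamma_profile \<alpha> t / t"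
proof -
  have "\<alpha> powr \<alpha> * exp (- \<alpha>) * gamma_profile \<alpha> t = exp (\<alpha> * ln t - t)"
    using assms by (simp add: gamma_profile_def powr_def ln_div exp_add[symmetric] algebra_simps)
  moreover have "t powr (\<alpha> - 1) * exp (- t) = exp (\<alpha> * ln t - t) / t"
    using assms by (simp add: powr_def algebra_simps exp_diff exp_minus field_simps)
  ultimately show ?thesis using assms
    by (simp add: gamma_density_def gamma_peak_def)
qed

lemma gamma_profile_le:
  assumes "\<alpha> > 0" "t > 0"
  shows "gamma_profile \<alpha> t \<le> exp (- ((t - \<alpha>)\<^sup>2 / (2 * max t \<alpha>)))"
proof -
  have sq: "\<alpha> * (t / \<alpha> - 1)\<^sup>2 = (t - \<alpha>)\<^sup>2 / \<alpha>"
    using assms by (simp add: field_simps power2_eq_square)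
  have "(t - \<alpha>)\<^sup>2 / (2 * max t \<alpha>) \<le> \<alpha> * (t / \<alpha> - 1 - ln (t / \<alpha>))"
  proof (cases "t \<ge> \<alpha>")
    case True
    have "(t - \<alpha>)\<^sup>2 / (2 * max t \<alpha>) = \<alpha> * ((t / \<alpha> - 1)\<^sup>2 / (2 * (t / \<alpha>)))"
      using assms True by (simp add: max_absorb1 field_simps power2_eq_square)
    also have "\<dots> \<le> \<alpha> * (t / \<alpha> - 1 - ln (t / \<alpha>))"
      using assms True by (intro mult_left_mono rate_ge_right_of_one) auto
    finally show ?thesis .
  next
    case False
    have "\<alpha> * ((t / \<alpha> - 1)\<^sup>2 / 2) \<le> \<alpha> * (t / \<alpha> - 1 - ln (t / \<alpha>))"
      using assms False by (intro mult_left_mono rate_ge_left_of_one) auto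
    then show ?thesis using False sq by (simp add: max_def)
  qed
  then show ?thesis by (simp add: gamma_profile_def)
qed

text \<open>
  The bound \<open>ln (\<alpha> / t) \<le> \<alpha> / t - 1\<close> works on both sides of the mean, so one estimate serves the lower
  bounds for both tails.
\<close>

lemma gamma_profile_ge:
  assumes "\<alpha> > 0" "t > 0"
  shows "exp (- ((t - \<alpha>)\<^sup>2 / t)) \<le> gamma_profile \<alpha> t"
proof -
  have "ln (\<alpha> / t) \<le> \<alpha> / t - 1"
    using assms by (intro ln_le_minus_one) auto
  then have "t / \<alpha> - 1 - ln (t / \<alpha>) \<le> t / \<alpha> + \<alpha> / t - 2"
    using assms by (simp add: ln_div)
  then have "\<alpha> * (t / \<alpha> - 1 - ln (t / \<alpha>)) \<le> \<alpha> * (t / \<alpha> + \<alpha> / t - 2)"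
    using assms by (intro mult_left_mono) auto
  also have "\<dots> = (t - \<alpha>)\<^sup>2 / t"
    using assms by (simp add: field_simps power2_eq_square)
  finally show ?thesis by (simp add: gamma_profile_def)
qed

section \<open>Probabilities as integrals of the density\<close>

lemma gamma_density_nonneg: "\<alpha> > 0 \<Longrightarrow> 0 \<le> gamma_density \<alpha> y"
  using Gamma_real_pos[of \<alpha>] by (simp add: gamma_density_def)

lemma integrable_gamma_density:
  assumes "\<alpha> > 0"
  shows "integrable lborel (gamma_density \<alpha>)"
proof (rule integrableI_nonneg)
  interpret prob_space "gamma_distribution \<alpha>" by (rule prob_space_gamma_distribution[OF assms])
  show "(\<integral>\<^sup>+ y. ennreal (gamma_density \<alpha> y) \<partial>lborel) < \<infinity>"
    using emeasure_space_1 by (simp add: gamma_distribution_def emeasure_density)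
qed (use assms in \<open>auto intro: gamma_density_nonneg\<close>)

lemma integrable_indicator_gamma_density:
  assumes "\<alpha> > 0" "S \<in> sets borel"
  shows "integrable lborel (\<lambda>y. indicator S y * gamma_density \<alpha> y)"
  using integrable_mult_indicator[OF _ integrable_gamma_density[OF assms(1)], of S] assms(2)
  by simp

lemma measure_gamma_distribution_eq:
  assumes "\<alpha> > 0" "S \<in> sets borel"
  shows "measure (gamma_distribution \<alpha>) S = (\<integral>y. indicator S y * gamma_density \<alpha> y \<partial>lborel)"
proof -
  have "measure (gamma_distribution \<alpha>) S = (\<integral>y. indicator S y \<partial>gamma_distribution \<alpha>)"
    by simp
  also have "\<dots> = (\<integral>y. gamma_density \<alpha> y * indicator S y \<partial>lborel)"
    unfolding gamma_distribution_def using assms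
    by (subst integral_real_density) (auto intro: gamma_density_nonneg)
  finally show ?thesis by (simp add: mult.commute)
qed

lemma has_integral_gamma_density:
  assumes "\<alpha> > 0" "S \<in> sets borel"
  shows "(gamma_density \<alpha> has_integral measure (gamma_distribution \<alpha>) S) S"
proof -
  have "set_integrable lborel S (gamma_density \<alpha>)"
    using integrable_indicator_gamma_density[OF assms] by (simp add: set_integrable_def)
  from set_borel_integral_eq_integral[OF this] show ?thesis
    using assms by (simp add: has_integral_iff measure_gamma_distribution_eq set_lebesgue_integral_def)
qed

lemma prob_gamma_tail_eq:
  "\<P>(Y in gamma_distribution \<alpha>. Y - \<alpha> \<ge> x) = measure (gamma_distribution \<alpha>) {\<alpha> + x..}"
  "\<P>(Y in gamma_distribution \<alpha>. Y - \<alpha> \<le> - x) = measure (gamma_distribution \<alpha>) {..\<alpha> - x}"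
  by (auto intro!: arg_cong[where f = "measure (gamma_distribution \<alpha>)"])

lemma measure_gamma_distribution_mono:
  assumes "\<alpha> > 0" "S \<subseteq> T" "S \<in> sets borel" "T \<in> sets borel"
  shows "measure (gamma_distribution \<alpha>) S \<le> measure (gamma_distribution \<alpha>) T"
proof -
  interpret prob_space "gamma_distribution \<alpha>" by (rule prob_space_gamma_distribution[OF assms(1)])
  show ?thesis using assms by (intro finite_measure_mono) auto
qed

lemma measure_gamma_distribution_nonpos:
  assumes "\<alpha> > 0" "t \<le> 0"
  shows "measure (gamma_distribution \<alpha>) {..t} = 0"
proof -
  have "indicator {..t} y * gamma_density \<alpha> y = 0" for y
    using assms by (auto simp: gamma_density_def indicator_def)
  moreover have "{..t} \<in> sets borel" by simp
  ultimately show ?thesis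
    by (simp only: measure_gamma_distribution_eq[OF assms(1)] integral_zero)
qed

lemma measure_gamma_distribution_Icc_bounds:
  assumes "\<alpha> > 0" "a \<le> b"
  shows "(\<And>y. y \<in> {a..b} \<Longrightarrow> m \<le> gamma_density \<alpha> y) \<Longrightarrow>
      m * (b - a) \<le> measure (gamma_distribution \<alpha>) {a..b}"
    and "(\<And>y. y \<in> {a..b} \<Longrightarrow> gamma_density \<alpha> y \<le> m) \<Longrightarrow>
      measure (gamma_distribution \<alpha>) {a..b} \<le> m * (b - a)"
  using has_integral_le[OF has_integral_const_real has_integral_gamma_density[of \<alpha> "{a..b}"], of m]
    has_integral_le[OF has_integral_gamma_density[of \<alpha> "{a..b}"] has_integral_const_real, of m] assms
  by (auto simp: mult.commute)

section \<open>Chernoff bounds and the density near the mean\<close>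

text \<open>
  Chernoff's inequality, with the exponential tilt carried out on densities: tilting the law with shape
  \<open>\<alpha>\<close> by \<open>exp ((1 - r) * y)\<close> turns it into the law of \<open>Y / r\<close>. The choice \<open>r = \<alpha> / t\<close> moves its mean to
  \<open>t\<close>, and is optimal. The condition on \<open>S\<close> says that \<open>S\<close> lies beyond \<open>t\<close> as seen from the mean, which
  treats both tails at once; for \<open>t = \<alpha>\<close> the bound is trivially \<open>1\<close>.
\<close>

lemma measure_gamma_distribution_le_profile:
  assumes "\<alpha> > 0" "t > 0" "S \<in> sets borel"
    and side: "\<And>y. y \<in> S \<Longrightarrow> 0 \<le> (y - t) * (t - \<alpha>)"
  shows "measure (gamma_distribution \<alpha>) S \<le> gamma_profile \<alpha> t"
proof -
  define r where "r = \<alpha> / t"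
  have r: "r > 0" using assms by (simp add: r_def)
  have profile: "gamma_profile \<alpha> t = r powr - \<alpha> * exp ((r - 1) * t)"
    using assms by (simp add: gamma_profile_def r_def powr_def ln_div exp_add[symmetric] field_simps)
  \<comment> \<open>On \<open>S\<close> the ratio of the original to the tilted density is at most its value at \<open>t\<close>, the profile.\<close>
  have tilt: "indicator S y * gamma_density \<alpha> y \<le> gamma_profile \<alpha> t * (r * gamma_density \<alpha> (r * y))" for y
  proof (cases "y \<in> S \<and> y > 0")
    case True
    then have y: "y > 0" and "0 \<le> (y - t) * (t - \<alpha>) / t"
      using side assms(2) by auto
    moreover have "(r - 1) * t - (r - 1) * y = (y - t) * (t - \<alpha>) / t"
      using assms(2) by (simp add: r_def field_simps)
    ultimately have "(r - 1) * y \<le> (r - 1) * t"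
      by linarith
    moreover have "gamma_density \<alpha> y
        = r powr - \<alpha> * exp ((r - 1) * y) * (r * gamma_density \<alpha> (r * y))"
      using y r by (simp add: gamma_density_def powr_mult powr_minus powr_diff exp_minus
          exp_diff left_diff_distrib field_simps)
    ultimately show ?thesis
      using True r gamma_density_nonneg[OF assms(1)]
      by (auto simp: profile intro!: mult_right_mono)
  next
    case False
    have "0 \<le> gamma_profile \<alpha> t * (r * gamma_density \<alpha> (r * y))"
      using r gamma_density_nonneg[OF assms(1)] by (simp add: gamma_profile_def)
    with False show ?thesis by (auto simp: gamma_density_def)
  qed
  have int: "integrable lborel (\<lambda>y. gamma_density \<alpha> (0 + r * y))"
    using r by (intro lborel_integrable_real_affine integrable_gamma_density assms) auto
  have "measure (gamma_distribution \<alpha>) S \<le> (\<integral>y. gamma_profile \<alpha> t * (r * gamma_density \<alpha> (r * y)) \<partial>lborel)"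
    unfolding measure_gamma_distribution_eq[OF assms(1,3)]
    using int by (intro integral_mono integrable_indicator_gamma_density assms tilt) auto
  also have "\<dots> = gamma_profile \<alpha> t * (\<integral>y. gamma_density \<alpha> y \<partial>lborel)"
    using r by (subst lborel_integral_real_affine[where c = r and t = 0]) auto
  also have "(\<integral>y. gamma_density \<alpha> y \<partial>lborel) = 1"
  proof -
    interpret prob_space "gamma_distribution \<alpha>" by (rule prob_space_gamma_distribution[OF assms(1)])
    show ?thesis
      using measure_gamma_distribution_eq[OF assms(1), of UNIV] prob_space by simp
  qed
  finally show ?thesis by simp
qed

text \<open>
  A substitute for the upper half of Stirling's formula. The window \<open>{a..b}\<close> has width of order
  \<open>sqrt \<alpha>\<close> and does not go below \<open>\<alpha> / 2\<close>, so its probability is at most of order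
  \<open>gamma_peak \<alpha> / sqrt \<alpha>\<close>. It is also bounded below, because the Chernoff bounds \<open>8 / 9\<close> and
  \<open>1 / 50\<close> for the two tails that it omits add up to less than \<open>1\<close>. The window is lopsided since its left
  end must not fall below \<open>\<alpha> / 2\<close> even for \<open>\<alpha> = 1\<close>; the left tail bound is then weak, and the right end
  compensates for it.
\<close>

lemma gamma_peak_ge:
  assumes "\<alpha> \<ge> 1"
  shows "sqrt \<alpha> / 2500 \<le> gamma_peak \<alpha>"
proof -
  interpret prob_space "gamma_distribution \<alpha>"
    using assms by (intro prob_space_gamma_distribution) simp
  define s where "s = sqrt \<alpha>"
  have s: "s \<ge> 1" "\<alpha> = s * s" using assms by (auto simp: s_def)
  define a b where "a = \<alpha> - s / 2" and "b = \<alpha> + 100 * s"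
  have a: "\<alpha> / 2 \<le> a" "a \<le> \<alpha>" "a > 0" and b: "\<alpha> \<le> b"
    using s by (auto simp: a_def b_def intro: mult_left_mono add_strict_increasing)
  have lower: "prob {..a} \<le> 8 / 9"
  proof -
    have "prob {..a} \<le> gamma_profile \<alpha> a"
      using a assms by (intro measure_gamma_distribution_le_profile) (auto intro: mult_nonpos_nonpos)
    also have "\<dots> \<le> exp (- (1 / 8))"
      using gamma_profile_le[of \<alpha> a] a assms s by (simp add: a_def power2_eq_square max_def)
    also have "\<dots> \<le> 8 / 9"
      using exp_ge_add_one_self[of "1 / 8 :: real"] by (simp add: exp_minus field_simps)
    finally show ?thesis .
  qed
  have upper: "prob {b..} \<le> 1 / 50"
  proof -
    have "prob {b..} \<le> gamma_profile \<alpha> b"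
      using b assms by (intro measure_gamma_distribution_le_profile) auto
    also have "\<dots> \<le> exp (- ((b - \<alpha>)\<^sup>2 / (2 * b)))"
      using gamma_profile_le[of \<alpha> b] b assms by (simp add: max_def)
    also have "\<dots> \<le> exp (- 49)"
    proof -
      have "b \<le> s * s + 100 * (s * s)"
        unfolding b_def s(2) using s(1) by (intro add_left_mono mult_left_mono) (auto intro: mult_left_mono)
      moreover have "(b - \<alpha>)\<^sup>2 = 10000 * (s * s)"
        by (simp add: b_def power2_eq_square)
      ultimately have "49 * (2 * b) \<le> (b - \<alpha>)\<^sup>2"
        using zero_le_square[of s] by linarith
      then show ?thesis using a b by (simp add: field_simps)
    qed
    also have "\<dots> \<le> 1 / 50"
      using exp_ge_add_one_self[of "49 :: real"] by (simp add: exp_minus field_simps)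
    finally show ?thesis .
  qed
  have peak0: "gamma_peak \<alpha> \<ge> 0"
    using assms by (simp add: gamma_peak_def Gamma_real_nonneg)
  have "prob {a..b} \<le> gamma_peak \<alpha> / a * (b - a)"
  proof (rule measure_gamma_distribution_Icc_bounds)
    fix y assume y: "y \<in> {a..b}"
    then have "gamma_profile \<alpha> y \<le> 1"
      using a assms gamma_profile_le[of \<alpha> y] by (smt (verit) atLeastAtMost_iff exp_le_one_iff
          divide_nonneg_pos zero_le_power2)
    then show "gamma_density \<alpha> y \<le> gamma_peak \<alpha> / a"
      using y a assms peak0
      by (subst gamma_density_eq_profile) (auto intro!: frac_le simp: mult_left_le)
  qed (use a b assms in auto)
  also have "\<dots> \<le> gamma_peak \<alpha> / (\<alpha> / 2) * (b - a)"
    using a b assms peak0 by (intro mult_right_mono divide_left_mono) auto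
  also have "\<dots> = 201 * gamma_peak \<alpha> / s"
    using s by (simp add: a_def b_def field_simps)
  finally have window: "prob {a..b} \<le> 201 * gamma_peak \<alpha> / s" .
  have "1 = prob ({..a} \<union> {a..b} \<union> {b..})"
  proof -
    have "{..a} \<union> {a..b} \<union> {b..} = UNIV" by auto
    then show ?thesis using prob_space by simp
  qed
  also have "\<dots> \<le> prob {..a} + prob {a..b} + prob {b..}"
    using measure_Un_le[of "{..a}" "gamma_distribution \<alpha>" "{a..b}"]
      measure_Un_le[of "{..a} \<union> {a..b}" "gamma_distribution \<alpha>" "{b..}"] by simp
  finally have "201 / 2500 \<le> 201 * gamma_peak \<alpha> / s"
    using lower upper window by simp
  then show ?thesis using s by (simp add: s_def[symmetric] field_simps)
qed

text \<open>
  Each lower bound for a tail at shape \<open>\<alpha> \<ge> 1\<close> comes from this estimate, for intervals that start at the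
  threshold and extend away from the mean.
\<close>

lemma measure_gamma_distribution_Icc_ge:
  assumes "\<alpha> \<ge> 1" "0 < a" "a \<le> b"
    and Q: "\<And>t. t \<in> {a..b} \<Longrightarrow> (t - \<alpha>)\<^sup>2 / t \<le> Q"
  shows "sqrt \<alpha> / 2500 * exp (- Q) * ((b - a) / b) \<le> measure (gamma_distribution \<alpha>) {a..b}"
proof -
  have "sqrt \<alpha> / 2500 * exp (- Q) / b * (b - a) \<le> measure (gamma_distribution \<alpha>) {a..b}"
  proof (rule measure_gamma_distribution_Icc_bounds)
    fix t assume t: "t \<in> {a..b}"
    have "exp (- Q) \<le> exp (- ((t - \<alpha>)\<^sup>2 / t))"
      using Q[OF t] by simp
    also have "\<dots> \<le> gamma_profile \<alpha> t"
      using t assms by (intro gamma_profile_ge) auto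
    finally have "sqrt \<alpha> / 2500 * exp (- Q) \<le> gamma_peak \<alpha> * gamma_profile \<alpha> t"
      using gamma_peak_ge[OF assms(1)] assms(1)
      by (intro mult_mono) (auto simp: order_trans[OF _ gamma_peak_ge])
    moreover have "0 \<le> gamma_peak \<alpha> * gamma_profile \<alpha> t"
      using order_trans[OF _ gamma_peak_ge[OF assms(1)], of 0] assms(1)
      by (simp add: gamma_profile_def)
    ultimately have "sqrt \<alpha> / 2500 * exp (- Q) / b \<le> gamma_peak \<alpha> * gamma_profile \<alpha> t / t"
      using t assms by (intro frac_le) auto
    then show "sqrt \<alpha> / 2500 * exp (- Q) / b \<le> gamma_density \<alpha> t"
      using t assms by (subst gamma_density_eq_profile) auto
  qed (use assms in auto)
  then show ?thesis by simp
qed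

section \<open>Tails for large shape\<close>

lemma min_linear_quadratic:
  assumes "(\<alpha>::real) > 0" "x \<ge> 0"
  shows "min x (x\<^sup>2 / \<alpha>) = (if x \<le> \<alpha> then x\<^sup>2 / \<alpha> else x)"
proof -
  have "x\<^sup>2 / \<alpha> \<le> x \<longleftrightarrow> x * x \<le> x * \<alpha>"
    using assms by (simp add: power2_eq_square divide_le_eq)
  also have "\<dots> \<longleftrightarrow> x \<le> \<alpha>"
    using assms by (auto simp: mult_le_cancel_left)
  finally show ?thesis by (auto simp: min_def)
qed

lemma gamma_upper_tail_le:
  assumes "\<alpha> \<ge> 1" "x \<ge> 0" "c \<le> 1 / 4"
  shows "measure (gamma_distribution \<alpha>) {\<alpha> + x..} \<le> exp (- c * min x (x\<^sup>2 / \<alpha>))"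
proof -
  have "measure (gamma_distribution \<alpha>) {\<alpha> + x..} \<le> gamma_profile \<alpha> (\<alpha> + x)"
    using assms by (intro measure_gamma_distribution_le_profile) auto
  also have "\<dots> \<le> exp (- (x\<^sup>2 / (2 * (\<alpha> + x))))"
    using gamma_profile_le[of \<alpha> "\<alpha> + x"] assms by (simp add: max_def split: if_splits)
  also have "\<dots> \<le> exp (- (1 / 4 * min x (x\<^sup>2 / \<alpha>)))"
  proof (cases "x \<le> \<alpha>")
    case True
    then have "x\<^sup>2 / (4 * \<alpha>) \<le> x\<^sup>2 / (2 * (\<alpha> + x))"
      using assms by (intro divide_left_mono) auto
    then show ?thesis using True assms by (simp add: min_linear_quadratic)
  next
    case False
    then have "x\<^sup>2 / (4 * x) \<le> x\<^sup>2 / (2 * (\<alpha> + x))"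
      using assms by (intro divide_left_mono) auto
    then show ?thesis using False assms by (simp add: min_linear_quadratic power2_eq_square)
  qed
  also have "\<dots> \<le> exp (- c * min x (x\<^sup>2 / \<alpha>))"
    using mult_right_mono[OF assms(3), of "min x (x\<^sup>2 / \<alpha>)"] assms by simp
  finally show ?thesis .
qed

lemma gamma_lower_tail_le:
  assumes "\<alpha> > 0" "0 \<le> x" "x < \<alpha>"
  shows "measure (gamma_distribution \<alpha>) {..\<alpha> - x} \<le> exp (- (x\<^sup>2 / (2 * \<alpha>)))"
proof -
  have "measure (gamma_distribution \<alpha>) {..\<alpha> - x} \<le> gamma_profile \<alpha> (\<alpha> - x)"
    using assms by (intro measure_gamma_distribution_le_profile) (auto intro: mult_nonpos_nonneg)
  also have "\<dots> \<le> exp (- (x\<^sup>2 / (2 * \<alpha>)))"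
    using gamma_profile_le[of \<alpha> "\<alpha> - x"] assms by (simp add: max_def split: if_splits)
  finally show ?thesis .
qed

text \<open>
  For \<open>x \<le> \<alpha>\<close> an interval of length \<open>sqrt \<alpha>\<close> beyond the threshold at most doubles the Gaussian
  exponent and adds a constant to it. For \<open>x > \<alpha>\<close> one can afford an interval of length \<open>x\<close>, as doubling \<open>x\<close>
  merely doubles the linear exponent.
\<close>

lemma gamma_upper_tail_ge:
  assumes "\<alpha> \<ge> 1" "x \<ge> 0"
  shows "exp (- 2) / 7500 * exp (- 2 * min x (x\<^sup>2 / \<alpha>)) \<le> measure (gamma_distribution \<alpha>) {\<alpha> + x..}"
proof -
  have tail: "measure (gamma_distribution \<alpha>) {\<alpha> + x..b} \<le> measure (gamma_distribution \<alpha>) {\<alpha> + x..}" for b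
    using assms by (intro measure_gamma_distribution_mono) auto
  define s where "s = sqrt \<alpha>"
  have s: "s \<ge> 1" "s * s = \<alpha>" using assms by (auto simp: s_def)
  have s_le: "s \<le> \<alpha>" using s mult_left_mono[of 1 s s] by auto
  show ?thesis
  proof (cases "x \<le> \<alpha>")
    case True
    let ?b = "\<alpha> + x + s"
    have "sqrt \<alpha> / 2500 * exp (- (2 * x\<^sup>2 / \<alpha> + 2)) * ((?b - (\<alpha> + x)) / ?b)
        \<le> measure (gamma_distribution \<alpha>) {\<alpha> + x..?b}"
    proof (rule measure_gamma_distribution_Icc_ge)
      fix t assume t: "t \<in> {\<alpha> + x..?b}"
      have "(t - \<alpha>)\<^sup>2 / t \<le> (x + s)\<^sup>2 / \<alpha>"
        using t assms s by (intro frac_le power_mono) auto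
      also have "\<dots> \<le> (2 * x\<^sup>2 + 2 * s\<^sup>2) / \<alpha>"
        using assms sum_squares_bound[of x s] by (intro divide_right_mono) (auto simp: power2_sum)
      also have "\<dots> = 2 * x\<^sup>2 / \<alpha> + 2"
        using s assms by (simp add: add_divide_distrib power2_eq_square)
      finally show "(t - \<alpha>)\<^sup>2 / t \<le> 2 * x\<^sup>2 / \<alpha> + 2" .
    qed (use assms s in auto)
    moreover have "exp (- 2) / 7500 * exp (- 2 * min x (x\<^sup>2 / \<alpha>))
        \<le> sqrt \<alpha> / 2500 * exp (- (2 * x\<^sup>2 / \<alpha> + 2)) * ((?b - (\<alpha> + x)) / ?b)"
    proof -
      have "min x (x\<^sup>2 / \<alpha>) = x\<^sup>2 / \<alpha>"
        using True assms by (simp add: min_linear_quadratic)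
      then have "exp (- 2) / 7500 * exp (- 2 * min x (x\<^sup>2 / \<alpha>)) = exp (- (2 * x\<^sup>2 / \<alpha> + 2)) / 2500 * (1 / 3)"
        by (simp add: exp_add[symmetric] exp_diff exp_minus field_simps)
      also have "\<dots> \<le> exp (- (2 * x\<^sup>2 / \<alpha> + 2)) / 2500 * (s * s / ?b)"
        using True s s_le assms by (intro mult_left_mono) (auto simp: field_simps)
      also have "\<dots> = s / 2500 * exp (- (2 * x\<^sup>2 / \<alpha> + 2)) * ((?b - (\<alpha> + x)) / ?b)"
        by simp
      finally show ?thesis by (simp only: s_def)
    qed
    ultimately show ?thesis using tail[of ?b] by linarith
  next
    case False
    let ?b = "\<alpha> + x + x"
    have "sqrt \<alpha> / 2500 * exp (- (2 * x)) * ((?b - (\<alpha> + x)) / ?b)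
        \<le> measure (gamma_distribution \<alpha>) {\<alpha> + x..?b}"
    proof (rule measure_gamma_distribution_Icc_ge)
      fix t assume t: "t \<in> {\<alpha> + x..?b}"
      have "(t - \<alpha>)\<^sup>2 / t \<le> (t - \<alpha>) * t / t"
        unfolding power2_eq_square using t assms
        by (intro divide_right_mono mult_left_mono) auto
      also have "\<dots> \<le> 2 * x" using t assms by auto
      finally show "(t - \<alpha>)\<^sup>2 / t \<le> 2 * x" .
    qed (use assms in auto)
    moreover have "exp (- 2) / 7500 * exp (- 2 * min x (x\<^sup>2 / \<alpha>))
        \<le> sqrt \<alpha> / 2500 * exp (- (2 * x)) * ((?b - (\<alpha> + x)) / ?b)"
    proof -
      have "min x (x\<^sup>2 / \<alpha>) = x"
        using False assms by (simp add: min_linear_quadratic)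
      then have "exp (- 2) / 7500 * exp (- 2 * min x (x\<^sup>2 / \<alpha>)) \<le> 1 / 2500 * exp (- (2 * x)) * (1 / 3)"
        by simp
      also have "\<dots> \<le> sqrt \<alpha> / 2500 * exp (- (2 * x)) * ((?b - (\<alpha> + x)) / ?b)"
        using False assms by (intro mult_mono divide_right_mono) (auto simp: field_simps)
      finally show ?thesis .
    qed
    ultimately show ?thesis using tail[of ?b] by linarith
  qed
qed

text \<open>
  For \<open>x \<le> \<alpha> / 4\<close> there is room for an interval of length \<open>sqrt \<alpha> / 2\<close> above \<open>\<alpha> / 4\<close>, and \<open>\<delta>\<close> does
  not enter. Otherwise the interval has length \<open>\<delta> * sqrt \<alpha> / 2\<close> and its points are only known to be at
  least \<open>\<delta> * \<alpha> / 2\<close>. The resulting prefactor \<open>\<delta>\<close> is at least \<open>exp (- 1 / \<delta>)\<close>, hence at least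
  \<open>exp (- 16 * x\<^sup>2 / (\<delta> * \<alpha>))\<close> because \<open>x\<^sup>2 / \<alpha> \<ge> 1 / 16\<close> in this range; it raises the constant in
  the exponent from \<open>32 / \<delta>\<close> to \<open>48 / \<delta>\<close>.
\<close>

lemma gamma_lower_tail_ge:
  assumes "\<alpha> \<ge> 1" "0 < \<delta>" "\<delta> \<le> 1" "0 \<le> x" "x \<le> \<alpha> * (1 - \<delta>)"
  shows "exp (- 2) / 7500 * exp (- (48 / \<delta>) * (x\<^sup>2 / \<alpha>)) \<le> measure (gamma_distribution \<alpha>) {..\<alpha> - x}"
proof -
  have tail: "measure (gamma_distribution \<alpha>) {a..\<alpha> - x} \<le> measure (gamma_distribution \<alpha>) {..\<alpha> - x}" for a
    using assms by (intro measure_gamma_distribution_mono) auto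
  define s where "s = sqrt \<alpha>"
  have s: "s \<ge> 1" "s * s = \<alpha>" using assms by (auto simp: s_def)
  have s_le: "s \<le> \<alpha>" using s mult_left_mono[of 1 s s] by auto
  \<comment> \<open>The Gaussian exponent as a single variable, so that the estimates become linear in it.\<close>
  define z where "z = x\<^sup>2 / \<alpha>"
  have z: "z \<ge> 0" "x\<^sup>2 = z * \<alpha>" using assms by (auto simp: z_def)
  have x_le: "\<alpha> - x \<le> \<alpha>" "\<alpha> - x \<ge> \<delta> * \<alpha>" "\<delta> * \<alpha> > 0" using assms by (auto simp: algebra_simps)
  have "exp (- 2) / 7500 * exp (- (48 / \<delta>) * z) \<le> measure (gamma_distribution \<alpha>) {..\<alpha> - x}"
  proof (cases "x \<le> \<alpha> / 4")
    case True
    let ?a = "\<alpha> - x - s / 2"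
    have a: "?a \<ge> \<alpha> / 4" using True s_le by simp
    have "sqrt \<alpha> / 2500 * exp (- (8 * z + 2)) * ((\<alpha> - x - ?a) / (\<alpha> - x))
        \<le> measure (gamma_distribution \<alpha>) {?a..\<alpha> - x}"
    proof (rule measure_gamma_distribution_Icc_ge)
      fix t assume t: "t \<in> {?a..\<alpha> - x}"
      have "(t - \<alpha>)\<^sup>2 / t = (\<alpha> - t)\<^sup>2 / t" by (simp add: power2_commute)
      also have "\<dots> \<le> (x + s / 2)\<^sup>2 / (\<alpha> / 4)"
        using t a assms by (intro frac_le power_mono) auto
      also have "\<dots> \<le> (2 * x\<^sup>2 + s * s / 2) / (\<alpha> / 4)"
        using assms sum_squares_bound[of x "s / 2"]
        by (intro divide_right_mono) (auto simp: power2_eq_square algebra_simps)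
      also have "\<dots> = 8 * z + 2"
        using assms by (simp add: s(2) z(2) add_divide_distrib)
      finally show "(t - \<alpha>)\<^sup>2 / t \<le> 8 * z + 2" .
    qed (use assms s a in auto)
    moreover have "exp (- 2) / 7500 * exp (- (48 / \<delta>) * z)
        \<le> sqrt \<alpha> / 2500 * exp (- (8 * z + 2)) * ((\<alpha> - x - ?a) / (\<alpha> - x))"
    proof -
      have "8 \<le> 48 / \<delta>" using assms by (simp add: field_simps)
      then have "exp (- (48 / \<delta>) * z) \<le> exp (- 8 * z)"
        using z by (simp only: exp_le_cancel_iff) (intro mult_right_mono, auto)
      then have "exp (- 2) / 7500 * exp (- (48 / \<delta>) * z) \<le> exp (- 2) / 7500 * exp (- 8 * z)"
        by (intro mult_left_mono) auto
      also have "\<dots> = exp (- (8 * z + 2)) / 2500 * (1 / 3)"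
        by (simp add: exp_add[symmetric] exp_diff exp_minus field_simps)
      also have "\<dots> \<le> exp (- (8 * z + 2)) / 2500 * (s * s / 2 / (\<alpha> - x))"
        using True s assms by (intro mult_left_mono) (auto simp: field_simps)
      also have "\<dots> = s / 2500 * exp (- (8 * z + 2)) * ((\<alpha> - x - ?a) / (\<alpha> - x))"
        by simp
      finally show ?thesis by (simp only: s_def)
    qed
    ultimately show ?thesis using tail[of ?a] by linarith
  next
    case False
    let ?a = "\<alpha> - x - \<delta> * s / 2"
    have "\<delta> * s \<le> \<delta> * \<alpha>" using s_le assms by (intro mult_left_mono) auto
    then have a: "?a \<ge> \<delta> * \<alpha> / 2" using x_le by linarith
    have sq: "\<alpha>\<^sup>2 \<le> 16 * x\<^sup>2"
      using power_mono[of \<alpha> "4 * x" 2] False assms by (simp add: power_mult_distrib)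
    have z1: "1 \<le> 16 * z"
    proof -
      have "\<alpha> * \<alpha> \<le> 16 * z * \<alpha>" using sq by (simp add: z(2) power2_eq_square[of \<alpha>])
      then have "\<alpha> \<le> 16 * z" using assms by simp
      then show ?thesis using assms by simp
    qed
    have "sqrt \<alpha> / 2500 * exp (- (32 * z / \<delta>)) * ((\<alpha> - x - ?a) / (\<alpha> - x))
        \<le> measure (gamma_distribution \<alpha>) {?a..\<alpha> - x}"
    proof (rule measure_gamma_distribution_Icc_ge)
      fix t assume t: "t \<in> {?a..\<alpha> - x}"
      have "(t - \<alpha>)\<^sup>2 / t = (\<alpha> - t)\<^sup>2 / t" by (simp add: power2_commute)
      also have "\<dots> \<le> \<alpha>\<^sup>2 / (\<delta> * \<alpha> / 2)"
      proof (intro frac_le power_mono)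
        show "\<delta> * \<alpha> / 2 \<le> t" "0 \<le> \<alpha> - t" "\<alpha> - t \<le> \<alpha>"
          using t a x_le assms(4) unfolding atLeastAtMost_iff by linarith+
      qed (use x_le in auto)
      also have "\<dots> \<le> 16 * x\<^sup>2 / (\<delta> * \<alpha> / 2)"
        using sq x_le by (intro divide_right_mono) auto
      also have "\<dots> = 32 * z / \<delta>"
        using assms by (simp add: z(2) field_simps)
      finally show "(t - \<alpha>)\<^sup>2 / t \<le> 32 * z / \<delta>" .
    next
      show "0 < ?a" using a x_le by linarith
    qed (use assms s in auto)
    moreover have "exp (- 2) / 7500 * exp (- (48 / \<delta>) * z)
        \<le> sqrt \<alpha> / 2500 * exp (- (32 * z / \<delta>)) * ((\<alpha> - x - ?a) / (\<alpha> - x))"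
    proof -
      have "exp (- (16 * z / \<delta>)) \<le> \<delta>"
      proof -
        have "1 / \<delta> \<le> 16 * z / \<delta>"
          using z1 assms by (intro divide_right_mono) auto
        also have "\<dots> \<le> exp (16 * z / \<delta>)"
          using exp_ge_add_one_self[of "16 * z / \<delta>"] by linarith
        finally show ?thesis using assms by (simp add: exp_minus field_simps)
      qed
      moreover have "exp (- (48 / \<delta>) * z) = exp (- (32 * z / \<delta>)) * exp (- (16 * z / \<delta>))"
        by (simp add: exp_add[symmetric] field_simps)
      ultimately have "exp (- (48 / \<delta>) * z) \<le> exp (- (32 * z / \<delta>)) * \<delta>"
        by simp
      then have "exp (- 2) / 7500 * exp (- (48 / \<delta>) * z) \<le> 1 / 7500 * (exp (- (32 * z / \<delta>)) * \<delta>)"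
        by (intro mult_mono) auto
      also have "\<dots> = exp (- (32 * z / \<delta>)) * \<delta> / 2500 * (1 / 3)"
        by simp
      also have "\<dots> \<le> exp (- (32 * z / \<delta>)) * \<delta> / 2500 * (s * s / 2 / (\<alpha> - x))"
      proof (intro mult_left_mono)
        have "0 < \<alpha> - x" using x_le by linarith
        then show "1 / 3 \<le> s * s / 2 / (\<alpha> - x)"
          using assms unfolding s(2) by (simp add: field_simps)
      qed (use assms in auto)
      also have "\<dots> = s / 2500 * exp (- (32 * z / \<delta>)) * ((\<alpha> - x - ?a) / (\<alpha> - x))"
        by simp
      finally show ?thesis by (simp only: s_def)
    qed
    ultimately show ?thesis using tail[of ?a] by linarith
  qed
  then show ?thesis by (simp add: z_def)
qed

section \<open>Tails for small shape\<close>

text \<open>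
  The left end \<open>a = 0\<close> is included, where the integrand may be singular and its primitive need not be
  differentiable; so the integral is obtained as a difference of two integrals from \<open>0\<close>.
\<close>

lemma has_integral_powr_Icc:
  assumes "(\<alpha>::real) > 0" "0 \<le> a" "a \<le> b"
  shows "((\<lambda>y. y powr (\<alpha> - 1)) has_integral (b powr \<alpha> - a powr \<alpha>) / \<alpha>) {a..b}"
proof -
  let ?f = "\<lambda>y::real. y powr (\<alpha> - 1)"
  have int: "(?f has_integral c powr \<alpha> / \<alpha>) {0..c}" if "c \<ge> 0" for c
    using has_integral_powr_from_0[of "\<alpha> - 1" c] assms that by simp
  have "?f integrable_on {0..b}"
    using int[of b] assms by (auto simp: integrable_on_def)
  then have "?f integrable_on {a..b}"
    using assms by (auto intro: integrable_on_subinterval)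
  then obtain c where c: "(?f has_integral c) {a..b}" by (auto simp: integrable_on_def)
  have "(?f has_integral a powr \<alpha> / \<alpha> + c) {0..b}"
    using assms by (intro has_integral_combine[OF _ _ int c]) auto
  moreover have "(?f has_integral b powr \<alpha> / \<alpha>) {0..b}"
    using assms by (intro int) auto
  ultimately have "a powr \<alpha> / \<alpha> + c = b powr \<alpha> / \<alpha>"
    by (rule has_integral_unique)
  then have "c = (b powr \<alpha> - a powr \<alpha>) / \<alpha>"
    by (simp add: diff_divide_distrib)
  with c show ?thesis by simp
qed

lemma gamma_measure_Icc_powr_bounds:
  assumes "\<alpha> > 0" "0 \<le> a" "a \<le> b"
  defines "I \<equiv> (b powr \<alpha> - a powr \<alpha>) / Gamma (\<alpha> + 1)"
  shows "exp (- b) * I \<le> measure (gamma_distribution \<alpha>) {a..b}"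
    and "measure (gamma_distribution \<alpha>) {a..b} \<le> exp (- a) * I"
proof -
  have G: "Gamma \<alpha> > 0" using assms by (simp add: Gamma_real_pos)
  have I: "I = (b powr \<alpha> - a powr \<alpha>) / \<alpha> / Gamma \<alpha>"
    using assms by (subst I_def, subst Gamma_plus1) (auto elim!: nonpos_Ints_cases)
  have int: "((\<lambda>y. k / Gamma \<alpha> * y powr (\<alpha> - 1)) has_integral k * I) {a..b}" for k
    using has_integral_mult_right[OF has_integral_powr_Icc[OF assms(1-3)], of "k / Gamma \<alpha>"]
    by (simp add: I field_simps)
  have dens: "gamma_density \<alpha> y = exp (- y) / Gamma \<alpha> * y powr (\<alpha> - 1)" if "y \<in> {a..b}" for y
    using that assms by (auto simp: gamma_density_def)
  have mono: "exp (- v) / Gamma \<alpha> * y powr (\<alpha> - 1) \<le> exp (- u) / Gamma \<alpha> * y powr (\<alpha> - 1)"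
    if "u \<le> v" for u v y
    using that G by (intro mult_right_mono divide_right_mono) simp_all
  show "exp (- b) * I \<le> measure (gamma_distribution \<alpha>) {a..b}"
  proof (rule has_integral_le[OF int has_integral_gamma_density])
    show "exp (- b) / Gamma \<alpha> * y powr (\<alpha> - 1) \<le> gamma_density \<alpha> y" if "y \<in> {a..b}" for y
      unfolding dens[OF that] using that by (intro mono) simp
  qed (use assms in simp_all)
  show "measure (gamma_distribution \<alpha>) {a..b} \<le> exp (- a) * I"
  proof (rule has_integral_le[OF has_integral_gamma_density int])
    show "gamma_density \<alpha> y \<le> exp (- a) / Gamma \<alpha> * y powr (\<alpha> - 1)" if "y \<in> {a..b}" for y
      unfolding dens[OF that] using that by (intro mono) simp
  qed (use assms in simp_all)
qed

text \<open>
  A step to the right by \<open>1\<close> multiplies \<open>exp (- y)\<close> by \<open>exp (- 1)\<close> and, as \<open>\<alpha> \<le> 1\<close>, does not increase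
  \<open>y powr (\<alpha> - 1)\<close>.
\<close>

lemma gamma_tail_shift_le:
  assumes "0 < \<alpha>" "\<alpha> \<le> 1" "t > 0"
  shows "measure (gamma_distribution \<alpha>) {t + 1..} \<le> exp (- 1) * measure (gamma_distribution \<alpha>) {t..}"
proof -
  have G: "Gamma \<alpha> > 0" using assms by (simp add: Gamma_real_pos)
  let ?f = "\<lambda>y. indicator {t + 1..} y * gamma_density \<alpha> y"
  have dens: "gamma_density \<alpha> (1 + y) \<le> exp (- 1) * gamma_density \<alpha> y" if "y \<ge> t" for y
  proof -
    have "(1 + y) powr (\<alpha> - 1) \<le> y powr (\<alpha> - 1)"
      using that assms by (intro powr_mono2') auto
    then have "(1 + y) powr (\<alpha> - 1) * exp (- (1 + y)) / Gamma \<alpha> \<le> y powr (\<alpha> - 1) * exp (- (1 + y)) / Gamma \<alpha>"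
      using G by (intro divide_right_mono mult_right_mono) auto
    also have "\<dots> = exp (- 1) * (y powr (\<alpha> - 1) * exp (- y) / Gamma \<alpha>)"
      by (simp add: exp_diff exp_minus divide_inverse mult_ac)
    finally show ?thesis
      using that assms by (simp add: gamma_density_def)
  qed
  have "measure (gamma_distribution \<alpha>) {t + 1..} = (\<integral>y. ?f y \<partial>lborel)"
    using assms by (intro measure_gamma_distribution_eq) auto
  also have "\<dots> = (\<integral>y. ?f (1 + 1 * y) \<partial>lborel)"
    by (rule trans[OF lborel_integral_real_affine[of 1 ?f 1]]) simp_all
  also have "\<dots> \<le> (\<integral>y. exp (- 1) * (indicator {t..} y * gamma_density \<alpha> y) \<partial>lborel)"
  proof (rule integral_mono)
    have "integrable lborel ?f"
      using assms by (intro integrable_indicator_gamma_density) auto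
    then show "integrable lborel (\<lambda>y. ?f (1 + 1 * y))"
      by (rule lborel_integrable_real_affine) simp
    show "integrable lborel (\<lambda>y. exp (- 1) * (indicator {t..} y * gamma_density \<alpha> y))"
      using assms by (intro integrable_mult_right integrable_indicator_gamma_density) auto
    show "?f (1 + 1 * y) \<le> exp (- 1) * (indicator {t..} y * gamma_density \<alpha> y)" for y
      using dens[of y] by (cases "y \<ge> t") simp_all
  qed
  also have "\<dots> = exp (- 1) * measure (gamma_distribution \<alpha>) {t..}"
    using assms by (simp add: measure_gamma_distribution_eq)
  finally show ?thesis .
qed

text \<open>
  Splitting the tail at \<open>t + 1\<close> and shifting its far part back gives \<open>G \<le> J + exp (- 1) * G\<close> for the tail
  \<open>G\<close> itself, which is the geometric series behind the factor \<open>exp 1 / (exp 1 - 1)\<close> in closed form.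
\<close>

lemma gamma_upper_tail_small_shape:
  assumes "0 < \<alpha>" "\<alpha> \<le> 1" "t > 0"
  defines "J \<equiv> ((t + 1) powr \<alpha> - t powr \<alpha>) / (exp t * Gamma (\<alpha> + 1))"
  shows "1 / exp 1 * J \<le> measure (gamma_distribution \<alpha>) {t..}"
    and "measure (gamma_distribution \<alpha>) {t..} \<le> exp 1 / (exp 1 - 1) * J"
proof -
  let ?m = "measure (gamma_distribution \<alpha>)"
  have "1 / exp 1 * J = exp (- (t + 1)) * (((t + 1) powr \<alpha> - t powr \<alpha>) / Gamma (\<alpha> + 1))"
    by (simp add: J_def exp_diff exp_minus divide_inverse mult_ac)
  also have "\<dots> \<le> ?m {t..t + 1}"
    using gamma_measure_Icc_powr_bounds(1)[of \<alpha> t "t + 1"] assms by simp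
  also have "\<dots> \<le> ?m {t..}"
    using assms by (intro measure_gamma_distribution_mono) auto
  finally show "1 / exp 1 * J \<le> ?m {t..}" .
  have "?m {t..} \<le> ?m {t..t + 1} + ?m {t + 1..}"
  proof -
    have "{t..} = {t..t + 1} \<union> {t + 1..}" by auto
    then show ?thesis using measure_Un_le[of "{t..t + 1}" "gamma_distribution \<alpha>" "{t + 1..}"] by simp
  qed
  also have "?m {t..t + 1} \<le> J"
    using gamma_measure_Icc_powr_bounds(2)[of \<alpha> t "t + 1"] assms
    by (simp add: J_def exp_minus field_simps)
  also have "?m {t + 1..} \<le> exp (- 1) * ?m {t..}"
    using assms by (intro gamma_tail_shift_le) auto
  finally have "?m {t..} * (1 - exp (- 1)) \<le> J" by (simp add: algebra_simps)
  moreover have "exp (1::real) - 1 > 0" by simp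
  ultimately show "?m {t..} \<le> exp 1 / (exp 1 - 1) * J"
    by (simp add: exp_minus field_simps)
qed

lemma gamma_lower_tail_small_shape:
  assumes "0 < \<alpha>" "t \<le> 1"
  shows "max t 0 powr \<alpha> / (exp 1 * Gamma (\<alpha> + 1)) \<le> measure (gamma_distribution \<alpha>) {..t}"
    and "measure (gamma_distribution \<alpha>) {..t} \<le> max t 0 powr \<alpha> / Gamma (\<alpha> + 1)"
proof -
  have G: "Gamma (\<alpha> + 1) > 0" using assms by (simp add: Gamma_real_pos)
  have "indicator {..t} y * gamma_density \<alpha> y = indicator {0..max t 0} y * gamma_density \<alpha> y" for y
    by (auto simp: gamma_density_def indicator_def)
  moreover have "{..t} \<in> sets borel" "{0..max t 0} \<in> sets borel" by simp_all
  ultimately have eq: "measure (gamma_distribution \<alpha>) {..t} = measure (gamma_distribution \<alpha>) {0..max t 0}"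
    by (simp only: measure_gamma_distribution_eq[OF assms(1)])
  have "max t 0 powr \<alpha> / (exp 1 * Gamma (\<alpha> + 1)) = exp (- 1) * (max t 0 powr \<alpha> / Gamma (\<alpha> + 1))"
    by (simp add: exp_minus field_simps)
  also have "\<dots> \<le> exp (- max t 0) * (max t 0 powr \<alpha> / Gamma (\<alpha> + 1))"
    using G assms by (intro mult_right_mono) auto
  finally show "max t 0 powr \<alpha> / (exp 1 * Gamma (\<alpha> + 1)) \<le> measure (gamma_distribution \<alpha>) {..t}"
    using gamma_measure_Icc_powr_bounds(1)[of \<alpha> 0 "max t 0"] assms by (simp add: eq)
  show "measure (gamma_distribution \<alpha>) {..t} \<le> max t 0 powr \<alpha> / Gamma (\<alpha> + 1)"
    using gamma_measure_Icc_powr_bounds(2)[of \<alpha> 0 "max t 0"] assms by (simp add: eq)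
qed

section \<open>The tail bounds with uniform constants\<close>

theorem theorem5:
  shows "\<exists>(c::real) (C::real) (C\<beta>::real \<Rightarrow> real).
    c > 0 \<and> C > 0 \<and> (\<forall>\<beta>>1. C\<beta> \<beta> > 0) \<and>
    (\<forall>\<alpha>\<ge>1. \<forall>x\<ge>0.
        c * exp (- C * min x (x\<^sup>2 / \<alpha>)) \<le> \<P>(Y in gamma_distribution \<alpha>. Y - \<alpha> \<ge> x) \<and>
        \<P>(Y in gamma_distribution \<alpha>. Y - \<alpha> \<ge> x) \<le> exp (- c * min x (x\<^sup>2 / \<alpha>))) \<and>
    (\<forall>\<beta>>1. \<forall>\<alpha>\<ge>1. \<forall>x. 0 \<le> x \<and> x \<le> \<alpha> / \<beta> \<longrightarrow>
        c * exp (- C\<beta> \<beta> * (x\<^sup>2 / \<alpha>)) \<le> \<P>(Y in gamma_distribution \<alpha>. Y - \<alpha> \<le> - x) \<and>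
        \<P>(Y in gamma_distribution \<alpha>. Y - \<alpha> \<le> - x) \<le> exp (- (x\<^sup>2 / (2 * \<alpha>)))) \<and>
    (\<forall>\<alpha>\<ge>1. \<forall>x>\<alpha>. \<P>(Y in gamma_distribution \<alpha>. Y - \<alpha> \<le> - x) = 0) \<and>
    (\<forall>\<alpha>. 0 < \<alpha> \<and> \<alpha> < 1 \<longrightarrow> (\<forall>x\<ge>0.
        1 / exp 1 * (((\<alpha> + x + 1) powr \<alpha> - (\<alpha> + x) powr \<alpha>) / (exp (\<alpha> + x) * Gamma (\<alpha> + 1)))
          \<le> \<P>(Y in gamma_distribution \<alpha>. Y - \<alpha> \<ge> x) \<and>
        \<P>(Y in gamma_distribution \<alpha>. Y - \<alpha> \<ge> x)
          \<le> exp 1 / (exp 1 - 1) *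
            (((\<alpha> + x + 1) powr \<alpha> - (\<alpha> + x) powr \<alpha>) / (exp (\<alpha> + x) * Gamma (\<alpha> + 1))) \<and>
        max (\<alpha> - x) 0 powr \<alpha> / (exp 1 * Gamma (\<alpha> + 1))
          \<le> \<P>(Y in gamma_distribution \<alpha>. Y - \<alpha> \<le> - x) \<and>
        \<P>(Y in gamma_distribution \<alpha>. Y - \<alpha> \<le> - x)
          \<le> max (\<alpha> - x) 0 powr \<alpha> / Gamma (\<alpha> + 1)))"
proof -
  \<comment> \<open>The prefactor of the lower bounds; being at most \<open>1 / 4\<close>, it can also serve in the upper exponent.\<close>
  let ?c = "exp (- 2) / 7500 :: real"
  have c: "?c > 0" "?c \<le> 1 / 4"
    using exp_le_one_iff[of "- 2 :: real"] by (simp, linarith)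
  have C: "48 / (1 - 1 / \<beta>) > 0" if "\<beta> > 1" for \<beta> :: real
    using that by simp
  have lower: "?c * exp (- (48 / (1 - 1 / \<beta>)) * (x\<^sup>2 / \<alpha>)) \<le> measure (gamma_distribution \<alpha>) {..\<alpha> - x}"
      "measure (gamma_distribution \<alpha>) {..\<alpha> - x} \<le> exp (- (x\<^sup>2 / (2 * \<alpha>)))"
    if "\<beta> > 1" "\<alpha> \<ge> 1" "0 \<le> x \<and> x \<le> \<alpha> / \<beta>" for \<alpha> \<beta> x :: real
  proof -
    have "\<alpha> / \<beta> < \<alpha>" using that by (simp add: field_simps)
    moreover have "x \<le> \<alpha> * (1 - (1 - 1 / \<beta>))" using that by simp
    ultimately show "?c * exp (- (48 / (1 - 1 / \<beta>)) * (x\<^sup>2 / \<alpha>)) \<le> measure (gamma_distribution \<alpha>) {..\<alpha> - x}"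
      "measure (gamma_distribution \<alpha>) {..\<alpha> - x} \<le> exp (- (x\<^sup>2 / (2 * \<alpha>)))"
      using that by (intro gamma_lower_tail_ge gamma_lower_tail_le; simp)+
  qed
  have zero: "measure (gamma_distribution \<alpha>) {..\<alpha> - x} = 0" if "\<alpha> \<ge> 1" "x > \<alpha>" for \<alpha> x :: real
    using that by (intro measure_gamma_distribution_nonpos) auto
  have small_up: "1 / exp 1 * (((\<alpha> + x + 1) powr \<alpha> - (\<alpha> + x) powr \<alpha>) / (exp (\<alpha> + x) * Gamma (\<alpha> + 1)))
        \<le> measure (gamma_distribution \<alpha>) {\<alpha> + x..}"
      "measure (gamma_distribution \<alpha>) {\<alpha> + x..} \<le> exp 1 / (exp 1 - 1) *
        (((\<alpha> + x + 1) powr \<alpha> - (\<alpha> + x) powr \<alpha>) / (exp (\<alpha> + x) * Gamma (\<alpha> + 1)))"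
    if "0 < \<alpha> \<and> \<alpha> < 1" "x \<ge> 0" for \<alpha> x :: real
    using that by (intro gamma_upper_tail_small_shape; simp)+
  have small_low: "max (\<alpha> - x) 0 powr \<alpha> / (exp 1 * Gamma (\<alpha> + 1)) \<le> measure (gamma_distribution \<alpha>) {..\<alpha> - x}"
      "measure (gamma_distribution \<alpha>) {..\<alpha> - x} \<le> max (\<alpha> - x) 0 powr \<alpha> / Gamma (\<alpha> + 1)"
    if "0 < \<alpha> \<and> \<alpha> < 1" "x \<ge> 0" for \<alpha> x :: real
    using that by (intro gamma_lower_tail_small_shape; simp)+
  show ?thesis
    unfolding prob_gamma_tail_eq
    by (intro exI[of _ ?c] exI[of _ 2] exI[of _ "\<lambda>\<beta>. 48 / (1 - 1 / \<beta>)"] conjI allI impI)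
      (fact c(1) zero_less_numeral C gamma_upper_tail_ge gamma_upper_tail_le[OF _ _ c(2)]
        lower zero small_up small_low)+
qed

end
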